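(* Let $\mathcal{M}$ be a connected manifold with a Riemannian metric $g$, let $f\colon\mathcal{M}\to\mathbb{R}$ be a differentiable function, and let $\phi\colon T\mathcal{M}\to\mathcal{M}$ be a retraction, with $\phi_p$ denoting its restriction to $T_p\mathcal{M}$. Consider the dynamic trivialization induced by $\phi$ for the problem $\min_{x\in\mathcal{M}}f(x)$ with $K=1$ (the basis is changed at every step), with basis points $p_0,p_1,\dots$. Then for every $i\ge 0$ \[ \mathrm{d}(f\circ\phi_{p_i})_0=(\mathrm{d}f)_{\phi_{p_i}(0)}\circ(\mathrm{d}\phi_{p_i})_0=(\mathrm{d}f)_{\phi_{p_i}(0)}=(\mathrm{d}f)_{p_i}, \qquad\text{hence}\qquad \nabla(f\circ\phi_{p_i})(0)=\nabla f(p_i). \] Consequently, when the Euclidean optimizer used to generate the iterates $y_{i,k}$ is regular SGD with learning rate $\eta>0$, the update rule becomes \[ y_{i,1}=-\eta\,\nabla f(p_i),\qquad p_{i+1}=\phi_{p_i}\bigl(-\eta\,\nabla f(p_i)\bigr), \] so that the points $p_{i+1}$ are exactly the iterates of (stochastic) Riemannian gradient descent using the retraction $\phi$. In particular, if the metric is complete and $\phi=\exp_{\mathcal{M}}$ is the Riemannian exponential map, one recovers (stochastic) Riemannian gradient descent along the exponential map.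
   Context: A retraction on $\mathcal{M}$ is a differentiable map $\phi\colon T\mathcal{M}\to\mathcal{M}$ such that for every $p\in\mathcal{M}$ the map $\phi_p=\phi|_{T_p\mathcal{M}}\colon T_p\mathcal{M}\to\mathcal{M}$ satisfies $\phi_p(0)=p$ and $(\mathrm{d}\phi_p)_0=\mathrm{Id}$ (identifying $T_0(T_p\mathcal{M})$ with $T_p\mathcal{M}$). $\nabla f$ is the Riemannian gradient of $f$, and $\nabla(f\circ\phi_p)$ is the gradient on the Euclidean space $(T_p\mathcal{M},g_p)$. Riemannian gradient descent along a retraction $r$ with step size $\eta>0$ is the iteration $x_{t+1}=r_{x_t}(-\eta\,\nabla f(x_t))$; Riemannian gradient descent along the exponential map is the case $r=\exp_{\mathcal{M}}$, where $\exp_{\mathcal{M},p}(v)=\gamma_{p,v}(1)$ and $\gamma_{p,v}$ is the geodesic with $\gamma_{p,v}(0)=p$, $\gamma_{p,v}'(0)=v$. Dynamic trivialization: given a retraction $\phi$, an integer $K>0$ (or $K=\infty$) and a starting point $p_0\in\mathcal{M}$, one considers the sequence of problems, for $i=0,1,\dots$, $\min_{y\in T_{p_i}\mathcal{M}}f(\phi_{p_i}(y))$, where $y_{i,1},\dots,y_{i,K}\in T_{p_i}\mathcal{M}$ are the approximations given by a Euclidean optimization algorithm (e.g. SGD, Adam, Adagrad, RMSprop) applied to the $i$-th problem with starting point $y_{i,0}=0$, and $p_{i+1}=\phi_{p_i}(y_{i,K})$. The point $p_i$ is called the basis at step $i$. An SGD step with learning rate $\eta$ from $y_{i,0}=0$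 is $y_{i,1}=y_{i,0}-\eta\,\nabla(f\circ\phi_{p_i})(y_{i,0})$; as is customary, the gradient of $f$ is written $\nabla f$ also in the stochastic setting. *)

theory Defs
  imports "HOL-Analysis.Analysis"
begin

section \<open>Smooth manifolds\<close>

text \<open>A chart is a pair of its domain and its coordinate map; the values of the coordinate map
  off the domain are irrelevant.\<close>

type_synonym ('a, 'e) chart = "'a set \<times> ('a \<Rightarrow> 'e)"
type_synonym ('a, 'e) atlas = "('a, 'e) chart set"

primrec Ck_on :: "nat \<Rightarrow> 'e::real_normed_vector set \<Rightarrow> ('e \<Rightarrow> 'f::real_normed_vector) \<Rightarrow> bool" where
  "Ck_on 0 S F \<longleftrightarrow> continuous_on S F"
| "Ck_on (Suc k) S F \<longleftrightarrow> (\<forall>x\<in>S. F differentiable (at x)) \<and>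
     (\<forall>v. Ck_on k S (\<lambda>x. frechet_derivative F (at x) v))"

definition smooth_on :: "'e::real_normed_vector set \<Rightarrow> ('e \<Rightarrow> 'f::real_normed_vector) \<Rightarrow> bool" where
  "smooth_on S F \<longleftrightarrow> (\<forall>k. Ck_on k S F)"

definition charts_at :: "('a, 'e) atlas \<Rightarrow> 'a \<Rightarrow> ('a, 'e) chart set" where
  "charts_at A p = {c \<in> A. p \<in> fst c}"

definition chart_inv :: "('a, 'e) chart \<Rightarrow> 'e \<Rightarrow> 'a" where
  "chart_inv c = inv_into (fst c) (snd c)"

definition local_rep :: "('a, 'e) chart \<Rightarrow> ('b, 'h) chart \<Rightarrow> ('a \<Rightarrow> 'b) \<Rightarrow> 'e \<Rightarrow> 'h" where
  "local_rep c d F = (\<lambda>x. snd d (F (chart_inv c x)))"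

abbreviation transition :: "('a, 'e) chart \<Rightarrow> ('a, 'h) chart \<Rightarrow> 'e \<Rightarrow> 'h" where
  "transition c d \<equiv> local_rep c d (\<lambda>p. p)"

definition smooth_manifold :: "'a topology \<Rightarrow> ('a, 'e::euclidean_space) atlas \<Rightarrow> bool" where
  "smooth_manifold X A \<longleftrightarrow>
     Hausdorff_space X \<and> second_countable X \<and> \<Union>(fst ` A) = topspace X \<and>
     (\<forall>c\<in>A. openin X (fst c) \<and> open (snd c ` fst c) \<and>
        homeomorphic_map (subtopology X (fst c)) (top_of_set (snd c ` fst c)) (snd c)) \<and>
     (\<forall>c\<in>A. \<forall>d\<in>A. smooth_on (snd c ` (fst c \<inter> fst d)) (transition c d))"

text \<open>The clause \<open>\<forall>x\<in>V. F (chart_inv c x) \<in> fst d\<close> makes \<open>F\<close> continuous at \<open>p\<close> and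
  ensures that the chart representation is a genuine one near \<open>p\<close>.\<close>

definition differentiable_map_at ::
  "('a, 'e::real_normed_vector) atlas \<Rightarrow> ('b, 'h::real_normed_vector) atlas \<Rightarrow> ('a \<Rightarrow> 'b) \<Rightarrow> 'a \<Rightarrow> bool" where
  "differentiable_map_at A B F p \<longleftrightarrow>
     (\<exists>c\<in>charts_at A p. \<exists>d\<in>charts_at B (F p). \<exists>V. open V \<and> snd c p \<in> V \<and> V \<subseteq> snd c ` fst c \<and>
        (\<forall>x\<in>V. F (chart_inv c x) \<in> fst d) \<and> local_rep c d F differentiable (at (snd c p)))"

definition differentiable_map ::
  "('a, 'e::real_normed_vector) atlas \<Rightarrow> ('b, 'h::real_normed_vector) atlas \<Rightarrow> ('a \<Rightarrow> 'b) \<Rightarrow> bool" where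
  "differentiable_map A B F \<longleftrightarrow> (\<forall>p\<in>\<Union>(fst ` A). differentiable_map_at A B F p)"

section \<open>Tangent spaces and differentials\<close>

text \<open>A tangent vector at \<open>p\<close> is given by its coordinate vectors in all charts of the atlas
  around \<open>p\<close>, which transform by the derivatives of the transition maps; its entries at all other
  pairs are set to 0, so that distinct functions are distinct tangent vectors. The vector space
  operations are pointwise.\<close>

type_synonym ('a, 'e) tangent = "('a, 'e) chart \<Rightarrow> 'e"

definition tangent_space :: "('a, 'e::real_normed_vector) atlas \<Rightarrow> 'a \<Rightarrow> ('a, 'e) tangent set" where
  "tangent_space A p = {v. (\<forall>c. c \<notin> charts_at A p \<longrightarrow> v c = 0) \<and>
     (\<forall>c\<in>charts_at A p. \<forall>d\<in>charts_at A p.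
        v d = frechet_derivative (transition c d) (at (snd c p)) (v c))}"

definition tzero :: "('a, 'e::real_vector) tangent" where
  "tzero = (\<lambda>_. 0)"

definition tscale :: "real \<Rightarrow> ('a, 'e::real_vector) tangent \<Rightarrow> ('a, 'e) tangent" where
  "tscale a v = (\<lambda>c. a *\<^sub>R v c)"

definition tadd :: "('a, 'e::real_vector) tangent \<Rightarrow> ('a, 'e) tangent \<Rightarrow> ('a, 'e) tangent" where
  "tadd v w = (\<lambda>c. v c + w c)"

definition differential ::
  "('a, 'e::real_normed_vector) atlas \<Rightarrow> ('b, 'h::real_normed_vector) atlas \<Rightarrow> ('a \<Rightarrow> 'b) \<Rightarrow> 'a \<Rightarrow>
     ('a, 'e) tangent \<Rightarrow> ('b, 'h) tangent" where
  "differential A B F p v =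
     (let c = (SOME c. c \<in> charts_at A p) in
      (\<lambda>d. if d \<in> charts_at B (F p)
            then frechet_derivative (local_rep c d F) (at (snd c p)) (v c) else 0))"

definition real_atlas :: "(real, real) atlas" where
  "real_atlas = {(UNIV, \<lambda>x. x)}"

text \<open>The differential of a real-valued function, with \<open>T\<^sub>x\<real>\<close> identified with \<open>\<real>\<close>.\<close>

definition real_differential ::
  "('a, 'e::real_normed_vector) atlas \<Rightarrow> ('a \<Rightarrow> real) \<Rightarrow> 'a \<Rightarrow> ('a, 'e) tangent \<Rightarrow> real" where
  "real_differential A f p v = differential A real_atlas f p v (UNIV, \<lambda>x. x)"

definition tangent_bundle_atlas ::
  "('a, 'e::real_normed_vector) atlas \<Rightarrow> ('a \<times> ('a, 'e) tangent, 'e \<times> 'e) atlas" where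
  "tangent_bundle_atlas A =
     (\<lambda>c. (Sigma (fst c) (tangent_space A), \<lambda>(p, v). (snd c p, v c))) ` A"

text \<open>The vector space \<open>T\<^sub>pM\<close> as a manifold: its charts are the linear coordinates induced by the
  charts of \<open>M\<close> around \<open>p\<close>. The map \<open>tangent_ident A p\<close> is the canonical identification of \<open>T\<^sub>pM\<close>
  with \<open>T\<^sub>y(T\<^sub>pM)\<close>, sending \<open>v\<close> to the velocity of \<open>t \<mapsto> y + tv\<close> (all charts being linear and
  global, it does not depend on \<open>y\<close>).\<close>

definition tangent_space_atlas ::
  "('a, 'e::real_normed_vector) atlas \<Rightarrow> 'a \<Rightarrow> (('a, 'e) tangent, 'e) atlas" where
  "tangent_space_atlas A p = (\<lambda>c. (tangent_space A p, \<lambda>v. v c)) ` charts_at A p"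

definition tangent_ident ::
  "('a, 'e::real_normed_vector) atlas \<Rightarrow> 'a \<Rightarrow> ('a, 'e) tangent \<Rightarrow> (('a, 'e) tangent, 'e) tangent" where
  "tangent_ident A p v = (\<lambda>d. if d \<in> tangent_space_atlas A p then snd d v else 0)"

definition manifold_retraction ::
  "('a, 'e::real_normed_vector) atlas \<Rightarrow> ('a \<Rightarrow> ('a, 'e) tangent \<Rightarrow> 'a) \<Rightarrow> bool" where
  "manifold_retraction A \<phi> \<longleftrightarrow>
     differentiable_map (tangent_bundle_atlas A) A (\<lambda>(p, v). \<phi> p v) \<and>
     (\<forall>p\<in>\<Union>(fst ` A). \<phi> p tzero = p \<and>
        (\<forall>v\<in>tangent_space A p.
           differential (tangent_space_atlas A p) A (\<phi> p) tzero (tangent_ident A p v) = v))"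

section \<open>Riemannian metrics and gradients\<close>

text \<open>The tangent vector at \<open>p\<close> whose coordinate vector in the chart \<open>c\<close> is \<open>u\<close>.\<close>

definition chart_vector ::
  "('a, 'e::real_normed_vector) atlas \<Rightarrow> ('a, 'e) chart \<Rightarrow> 'a \<Rightarrow> 'e \<Rightarrow> ('a, 'e) tangent" where
  "chart_vector A c p u =
     (\<lambda>d. if d \<in> charts_at A p then frechet_derivative (transition c d) (at (snd c p)) u else 0)"

type_synonym ('a, 'e) metric = "'a \<Rightarrow> ('a, 'e) tangent \<Rightarrow> ('a, 'e) tangent \<Rightarrow> real"

definition coord_metric ::
  "('a, 'e::real_normed_vector) atlas \<Rightarrow> ('a, 'e) metric \<Rightarrow> ('a, 'e) chart \<Rightarrow> 'e \<Rightarrow> 'e \<Rightarrow> 'e \<Rightarrow> real" where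
  "coord_metric A g c x u v =
     g (chart_inv c x) (chart_vector A c (chart_inv c x) u) (chart_vector A c (chart_inv c x) v)"

definition riemannian_metric :: "('a, 'e::euclidean_space) atlas \<Rightarrow> ('a, 'e) metric \<Rightarrow> bool" where
  "riemannian_metric A g \<longleftrightarrow>
     (\<forall>p\<in>\<Union>(fst ` A).
        (\<forall>u\<in>tangent_space A p. \<forall>v\<in>tangent_space A p. g p u v = g p v u) \<and>
        (\<forall>a. \<forall>u\<in>tangent_space A p. \<forall>v\<in>tangent_space A p. \<forall>w\<in>tangent_space A p.
           g p (tadd (tscale a u) v) w = a * g p u w + g p v w) \<and>
        (\<forall>v\<in>tangent_space A p. v \<noteq> tzero \<longrightarrow> g p v v > 0)) \<and>
     (\<forall>c\<in>A. \<forall>u v. smooth_on (snd c ` fst c) (\<lambda>x. coord_metric A g c x u v))"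

definition riemannian_gradient ::
  "('a, 'e::real_normed_vector) atlas \<Rightarrow> ('a, 'e) metric \<Rightarrow> ('a \<Rightarrow> real) \<Rightarrow> 'a \<Rightarrow> ('a, 'e) tangent" where
  "riemannian_gradient A g f p =
     (THE w. w \<in> tangent_space A p \<and>
        (\<forall>v\<in>tangent_space A p. g p w v = real_differential A f p v))"

text \<open>The gradient at \<open>y\<close> of a function \<open>h\<close> on the Euclidean space \<open>(T\<^sub>pM, g\<^sub>p)\<close>.\<close>

definition tangent_gradient ::
  "('a, 'e::real_normed_vector) atlas \<Rightarrow> ('a, 'e) metric \<Rightarrow> 'a \<Rightarrow> (('a, 'e) tangent \<Rightarrow> real) \<Rightarrow>
     ('a, 'e) tangent \<Rightarrow> ('a, 'e) tangent" where
  "tangent_gradient A g p h y =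
     (THE w. w \<in> tangent_space A p \<and>
        (\<forall>v\<in>tangent_space A p.
           g p w v = real_differential (tangent_space_atlas A p) h y (tangent_ident A p v)))"

section \<open>Geodesics, the exponential map, completeness\<close>

text \<open>The Christoffel symbols of the Levi-Civita connection in a chart, as a bilinear map:
  \<open>2 g(\<Gamma>(u, v), z) = D\<^sub>u g(v, z) + D\<^sub>v g(u, z) - D\<^sub>z g(u, v)\<close> for constant \<open>u, v, z\<close>.\<close>

definition christoffel ::
  "('a, 'e::real_normed_vector) atlas \<Rightarrow> ('a, 'e) metric \<Rightarrow> ('a, 'e) chart \<Rightarrow> 'e \<Rightarrow> 'e \<Rightarrow> 'e \<Rightarrow> 'e" where
  "christoffel A g c x u v =
     (THE w. \<forall>z. 2 * coord_metric A g c x w z =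
          frechet_derivative (\<lambda>y. coord_metric A g c y v z) (at x) u
        + frechet_derivative (\<lambda>y. coord_metric A g c y u z) (at x) v
        - frechet_derivative (\<lambda>y. coord_metric A g c y u v) (at x) z)"

definition velocity ::
  "('a, 'e::real_normed_vector) atlas \<Rightarrow> (real \<Rightarrow> 'a) \<Rightarrow> real \<Rightarrow> ('a, 'e) tangent" where
  "velocity A \<gamma> t =
     (\<lambda>c. if c \<in> charts_at A (\<gamma> t) then vector_derivative (\<lambda>s. snd c (\<gamma> s)) (at t) else 0)"

definition geodesic_on ::
  "('a, 'e::real_normed_vector) atlas \<Rightarrow> ('a, 'e) metric \<Rightarrow> real set \<Rightarrow> (real \<Rightarrow> 'a) \<Rightarrow> bool" where
  "geodesic_on A g I \<gamma> \<longleftrightarrow>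
     (\<forall>t\<in>I. \<exists>c\<in>A. \<exists>J. open J \<and> t \<in> J \<and> J \<subseteq> I \<and> \<gamma> ` J \<subseteq> fst c \<and>
        (\<exists>u. \<forall>s\<in>J. ((\<lambda>r. snd c (\<gamma> r)) has_vector_derivative u s) (at s) \<and>
           (u has_vector_derivative - christoffel A g c (snd c (\<gamma> s)) (u s) (u s)) (at s)))"

definition exp_map ::
  "('a, 'e::real_normed_vector) atlas \<Rightarrow> ('a, 'e) metric \<Rightarrow> 'a \<Rightarrow> ('a, 'e) tangent \<Rightarrow> 'a" where
  "exp_map A g p v =
     (THE q. \<exists>\<gamma> I. open I \<and> is_interval I \<and> {0..1} \<subseteq> I \<and> geodesic_on A g I \<gamma> \<and>
        \<gamma> 0 = p \<and> velocity A \<gamma> 0 = v \<and> \<gamma> 1 = q)"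

definition C1_curve_on ::
  "('a, 'e::real_normed_vector) atlas \<Rightarrow> real \<Rightarrow> real \<Rightarrow> (real \<Rightarrow> 'a) \<Rightarrow> bool" where
  "C1_curve_on A a b \<gamma> \<longleftrightarrow>
     (\<forall>t\<in>{a..b}. \<exists>c\<in>A. \<exists>\<delta>>0. let J = {a..b} \<inter> ball t \<delta> in
        \<gamma> ` J \<subseteq> fst c \<and>
        (\<exists>u. continuous_on J u \<and>
           (\<forall>s\<in>J. ((\<lambda>r. snd c (\<gamma> r)) has_vector_derivative u s) (at s within J))))"

definition piecewise_C1_path :: "('a, 'e::real_normed_vector) atlas \<Rightarrow> (real \<Rightarrow> 'a) \<Rightarrow> bool" where
  "piecewise_C1_path A \<gamma> \<longleftrightarrow>
     (\<exists>S. finite S \<and> {0, 1} \<subseteq> S \<and> S \<subseteq> {0..1} \<and>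
        (\<forall>a\<in>S. \<forall>b\<in>S. a < b \<and> {a<..<b} \<inter> S = {} \<longrightarrow> C1_curve_on A a b \<gamma>))"

definition curve_length ::
  "('a, 'e::real_normed_vector) atlas \<Rightarrow> ('a, 'e) metric \<Rightarrow> (real \<Rightarrow> 'a) \<Rightarrow> real" where
  "curve_length A g \<gamma> =
     integral {0..1} (\<lambda>t. sqrt (g (\<gamma> t) (velocity A \<gamma> t) (velocity A \<gamma> t)))"

definition riemannian_dist ::
  "('a, 'e::real_normed_vector) atlas \<Rightarrow> ('a, 'e) metric \<Rightarrow> 'a \<Rightarrow> 'a \<Rightarrow> real" where
  "riemannian_dist A g p q =
     Inf {curve_length A g \<gamma> |\<gamma>. piecewise_C1_path A \<gamma> \<and> \<gamma> 0 = p \<and> \<gamma> 1 = q}"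

text \<open>Completeness as a metric space; on a connected manifold this is, by Hopf--Rinow, the same as
  geodesic completeness, i.e. \<open>exp_map\<close> being defined on all of the tangent bundle.\<close>

definition complete_riemannian_metric ::
  "('a, 'e::real_normed_vector) atlas \<Rightarrow> ('a, 'e) metric \<Rightarrow> bool" where
  "complete_riemannian_metric A g \<longleftrightarrow>
     Metric_space.mcomplete (\<Union>(fst ` A)) (riemannian_dist A g)"

section \<open>Optimization\<close>

definition riemannian_gradient_descent ::
  "('a, 'e::real_normed_vector) atlas \<Rightarrow> ('a, 'e) metric \<Rightarrow> ('a \<Rightarrow> real) \<Rightarrow>
     ('a \<Rightarrow> ('a, 'e) tangent \<Rightarrow> 'a) \<Rightarrow> real \<Rightarrow> (nat \<Rightarrow> 'a) \<Rightarrow> bool" where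
  "riemannian_gradient_descent A g f r \<eta> x \<longleftrightarrow>
     (\<forall>t. x (Suc t) = r (x t) (tscale (- \<eta>) (riemannian_gradient A g f (x t))))"

text \<open>A Euclidean optimization algorithm is represented by the relation ``\<open>y 0, \<dots>, y K\<close> is a
  possible run of \<open>K\<close> steps on the objective \<open>h\<close> over \<open>T\<^sub>pM\<close>''; the starting point is \<open>y 0\<close>.\<close>

type_synonym ('a, 'e) optimizer =
  "'a \<Rightarrow> (('a, 'e) tangent \<Rightarrow> real) \<Rightarrow> nat \<Rightarrow> (nat \<Rightarrow> ('a, 'e) tangent) \<Rightarrow> bool"

definition sgd ::
  "('a, 'e::real_normed_vector) atlas \<Rightarrow> ('a, 'e) metric \<Rightarrow> real \<Rightarrow> ('a, 'e) optimizer" where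
  "sgd A g \<eta> p h K y \<longleftrightarrow>
     (\<forall>k<K. y (Suc k) = tadd (y k) (tscale (- \<eta>) (tangent_gradient A g p h (y k))))"

text \<open>\<open>p i\<close> is the basis at step \<open>i\<close>, and \<open>y i k\<close> is the \<open>k\<close>-th iterate for the problem of
  minimizing \<open>f \<circ> \<phi> (p i)\<close> over the tangent space at \<open>p i\<close>.\<close>

definition dynamic_trivialization ::
  "('a, 'e::real_normed_vector) atlas \<Rightarrow> ('a \<Rightarrow> real) \<Rightarrow> ('a \<Rightarrow> ('a, 'e) tangent \<Rightarrow> 'a) \<Rightarrow>
     ('a, 'e) optimizer \<Rightarrow> nat \<Rightarrow> 'a \<Rightarrow> (nat \<Rightarrow> 'a) \<Rightarrow> (nat \<Rightarrow> nat \<Rightarrow> ('a, 'e) tangent) \<Rightarrow> bool" where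
  "dynamic_trivialization A f \<phi> opt K p0 p y \<longleftrightarrow>
     K > 0 \<and> p0 \<in> \<Union>(fst ` A) \<and> p 0 = p0 \<and>
     (\<forall>i. y i 0 = tzero \<and> (\<forall>k\<le>K. y i k \<in> tangent_space A (p i)) \<and>
        opt (p i) (f \<circ> \<phi> (p i)) K (y i) \<and>
        p (Suc i) = \<phi> (p i) (y i K))"

end

theory Submission
  imports Defs
begin

text \<open>The chain rule together with \<open>(d\<phi>\<^sub>p)\<^sub>0 = Id\<close> identifies the differentials of
  \<open>f \<circ> \<phi>\<^sub>p\<close> at \<open>0\<close> and of \<open>f\<close> at \<open>p\<close>, hence the gradients, so that an SGD step from \<open>0\<close>
  is a step of Riemannian gradient descent. Conversely, a run of Riemannian gradient descent is
  a dynamic trivialization because the gradient exists as a tangent vector, by the Riesz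
  representation theorem in the coordinates of a chart.\<close>

section \<open>Charts, overlaps and transition maps\<close>

lemma charts_at_iff: "c \<in> charts_at A p \<longleftrightarrow> c \<in> A \<and> p \<in> fst c"
  by (simp add: charts_at_def)

lemma charts_at_nonempty:
  assumes "p \<in> \<Union>(fst ` A)"
  obtains c where "c \<in> charts_at A p"
  using assms by (auto simp: charts_at_iff)

lemma smooth_manifold_topspace: "smooth_manifold X A \<Longrightarrow> topspace X = \<Union>(fst ` A)"
  by (simp add: smooth_manifold_def)

lemma chart_homeomorphic:
  assumes "smooth_manifold X A" "c \<in> A"
  shows "homeomorphic_map (subtopology X (fst c)) (top_of_set (snd c ` fst c)) (snd c)"
    and "open (snd c ` fst c)" and "openin X (fst c)"
  using assms by (auto simp: smooth_manifold_def)

lemma chart_inj_on: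
  assumes "smooth_manifold X A" "c \<in> A"
  shows "inj_on (snd c) (fst c)"
proof -
  have "topspace (subtopology X (fst c)) = fst c"
    using chart_homeomorphic(3)[OF assms] openin_subset by (auto simp: topspace_subtopology)
  then show ?thesis
    using homeomorphic_imp_injective_map[OF chart_homeomorphic(1)[OF assms]] by simp
qed

lemma chart_inv_snd:
  assumes "smooth_manifold X A" "c \<in> A" "p \<in> fst c"
  shows "chart_inv c (snd c p) = p"
  unfolding chart_inv_def using chart_inj_on[OF assms(1,2)] assms(3) by (rule inv_into_f_f)

text \<open>A chart is an open map onto its image, and that image is open in the model space. Two
  chart representations that agree on the overlap can thus be compared on a genuine
  neighbourhood.\<close>

lemma open_chart_overlap:
  assumes "smooth_manifold X A" "c \<in> A" "d \<in> A"
  shows "open (snd c ` (fst c \<inter> fst d))"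
proof -
  have "openin (subtopology X (fst c)) (fst c \<inter> fst d)"
    using chart_homeomorphic(3)[OF assms(1,3)] by (simp add: openin_subtopology_Int2)
  then have "openin (top_of_set (snd c ` fst c)) (snd c ` (fst c \<inter> fst d))"
    using homeomorphic_imp_open_map[OF chart_homeomorphic(1)[OF assms(1,2)]]
    by (simp add: open_map_def)
  then show ?thesis
    using chart_homeomorphic(2)[OF assms(1,2)] openin_open_trans by blast
qed

lemma transition_has_derivative:
  assumes "smooth_manifold X A" "c \<in> charts_at A p" "d \<in> charts_at A p"
  shows "(transition c d has_derivative frechet_derivative (transition c d) (at (snd c p)))
           (at (snd c p))"
proof -
  have "smooth_on (snd c ` (fst c \<inter> fst d)) (transition c d)"
    using assms by (auto simp: smooth_manifold_def charts_at_iff)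
  then have "Ck_on (Suc 0) (snd c ` (fst c \<inter> fst d)) (transition c d)"
    by (simp only: smooth_on_def)
  then have "transition c d differentiable (at (snd c p))"
    using assms by (auto simp: charts_at_iff)
  then show ?thesis by (simp add: frechet_derivative_works)
qed

lemma linear_transition_derivative:
  assumes "smooth_manifold X A" "c \<in> charts_at A p" "d \<in> charts_at A p"
  shows "linear (frechet_derivative (transition c d) (at (snd c p)))"
  using transition_has_derivative[OF assms] has_derivative_linear by blast

lemma local_rep_transition:
  assumes "smooth_manifold X A" "d \<in> A" "x \<in> snd c ` (fst c \<inter> fst d)" "inj_on (snd c) (fst c)"
  shows "local_rep d e F (transition c d x) = local_rep c e F x"
proof -
  obtain q where q: "x = snd c q" "q \<in> fst c" "q \<in> fst d" using assms(3) by auto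
  have "chart_inv c x = q" using q assms(4) by (simp add: chart_inv_def)
  then show ?thesis
    using chart_inv_snd[OF assms(1,2) q(3)] by (simp add: local_rep_def)
qed

text \<open>The chain rule for the transition map. It is the source of every independence of the
  chart below.\<close>

lemma local_rep_change_chart:
  assumes M: "smooth_manifold X A" and c: "c \<in> charts_at A p" and d: "d \<in> charts_at A p"
    and D: "(local_rep d e F has_derivative D) (at (snd d p))"
  shows "(local_rep c e F has_derivative
           (\<lambda>u. D (frechet_derivative (transition c d) (at (snd c p)) u))) (at (snd c p))"
proof -
  have cd: "c \<in> A" "d \<in> A" "p \<in> fst c" "p \<in> fst d" using c d by (auto simp: charts_at_iff)
  have "transition c d (snd c p) = snd d p"
    using chart_inv_snd[OF M cd(1,3)] by (simp add: local_rep_def)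
  then have "((\<lambda>x. local_rep d e F (transition c d x)) has_derivative
      (\<lambda>u. D (frechet_derivative (transition c d) (at (snd c p)) u))) (at (snd c p))"
    using has_derivative_compose[OF transition_has_derivative[OF M c d], of "local_rep d e F" D] D
    by simp
  \<comment> \<open>The composite through \<open>d\<close> agrees with the direct representation on
    the overlap, an open set around the point, which suffices for derivatives.\<close>
  then show ?thesis
    by (rule has_derivative_transform_within_open[OF _ open_chart_overlap[OF M cd(1,2)]])
      (use cd in \<open>auto intro!: local_rep_transition[OF M cd(2) _ chart_inj_on[OF M cd(1)]]\<close>)
qed

text \<open>The cocycle law: the change-of-chart rule applied to the identity map, with uniqueness
  of the Frechet derivative.\<close>

lemma transition_derivative_compose:
  assumes M: "smooth_manifold X A"
    and c: "c \<in> charts_at A p" and d: "d \<in> charts_at A p" and e: "e \<in> charts_at A p"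
  shows "frechet_derivative (transition d e) (at (snd d p))
           (frechet_derivative (transition c d) (at (snd c p)) u)
         = frechet_derivative (transition c e) (at (snd c p)) u"
  using frechet_derivative_at[OF local_rep_change_chart[OF M c d transition_has_derivative[OF M d e]]]
  by metis

lemma transition_derivative_same:
  assumes M: "smooth_manifold X A" and c: "c \<in> charts_at A p"
  shows "frechet_derivative (transition c c) (at (snd c p)) u = u"
proof -
  have cA: "c \<in> A" "p \<in> fst c" using c by (auto simp: charts_at_iff)
  have "(transition c c has_derivative (\<lambda>u. u)) (at (snd c p))"
    by (rule has_derivative_transform_within_open[OF has_derivative_ident
          chart_homeomorphic(2)[OF M cA(1)]])
      (use cA in \<open>auto simp: local_rep_def chart_inv_snd[OF M cA(1)]\<close>)
  then show ?thesis using frechet_derivative_at by metis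
qed

section \<open>Tangent vectors and their coordinates\<close>

lemma tangent_spaceI:
  assumes "\<And>c. c \<notin> charts_at A p \<Longrightarrow> v c = 0"
    and "\<And>c d. c \<in> charts_at A p \<Longrightarrow> d \<in> charts_at A p \<Longrightarrow>
      frechet_derivative (transition c d) (at (snd c p)) (v c) = v d"
  shows "v \<in> tangent_space A p"
  unfolding tangent_space_def mem_Collect_eq using assms by metis

lemma tangent_space_transition:
  assumes "v \<in> tangent_space A p" "c \<in> charts_at A p" "d \<in> charts_at A p"
  shows "frechet_derivative (transition c d) (at (snd c p)) (v c) = v d"
  using assms unfolding tangent_space_def mem_Collect_eq by metis

lemma tangent_space_off_charts:
  assumes "v \<in> tangent_space A p" "c \<notin> charts_at A p"
  shows "v c = 0"
  using assms unfolding tangent_space_def mem_Collect_eq by metis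

text \<open>Compatibility between the coordinates in different charts is the cocycle law.\<close>

lemma chart_vector_mem:
  assumes "smooth_manifold X A" "c \<in> charts_at A p"
  shows "chart_vector A c p u \<in> tangent_space A p"
  by (rule tangent_spaceI)
    (simp_all add: chart_vector_def transition_derivative_compose[OF assms])

lemma chart_vector_same:
  assumes "smooth_manifold X A" "c \<in> charts_at A p"
  shows "chart_vector A c p u c = u"
  using assms by (simp add: chart_vector_def transition_derivative_same)

text \<open>With \<open>chart_vector_same\<close> this makes \<open>chart_vector A c p\<close> and
  evaluation at \<open>c\<close> inverse bijections between \<open>'e\<close> and the tangent
  space.\<close>

lemma chart_vector_coord:
  assumes "c \<in> charts_at A p" "v \<in> tangent_space A p"
  shows "chart_vector A c p (v c) = v"
  using tangent_space_transition[OF assms(2,1)] tangent_space_off_charts[OF assms(2)]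
  by (auto simp: chart_vector_def)

lemma chart_vector_linear:
  assumes "smooth_manifold X A" "c \<in> charts_at A p"
  shows "chart_vector A c p (a *\<^sub>R u + w)
    = tadd (tscale a (chart_vector A c p u)) (chart_vector A c p w)"
proof
  fix d show "chart_vector A c p (a *\<^sub>R u + w) d
    = tadd (tscale a (chart_vector A c p u)) (chart_vector A c p w) d"
    using linear_transition_derivative[OF assms, of d]
    by (auto simp: chart_vector_def tadd_def tscale_def linear_add linear_scale)
qed

lemma tzero_mem:
  assumes "smooth_manifold X A"
  shows "tzero \<in> tangent_space A p"
  by (rule tangent_spaceI)
    (simp_all add: tzero_def linear_0[OF linear_transition_derivative[OF assms]])

lemma tscale_mem:
  assumes "smooth_manifold X A" "v \<in> tangent_space A p"
  shows "tscale a v \<in> tangent_space A p"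
  by (rule tangent_spaceI)
    (simp_all add: tscale_def linear_scale[OF linear_transition_derivative[OF assms(1)]]
      tangent_space_transition[OF assms(2)] tangent_space_off_charts[OF assms(2)])

lemma tadd_tzero: "tadd tzero v = v"
  by (simp add: tadd_def tzero_def)

section \<open>Differentials of real-valued functions\<close>

lemma charts_at_real_atlas: "charts_at real_atlas x = {(UNIV, \<lambda>x. x)}"
  by (auto simp: charts_at_def real_atlas_def)

lemma local_rep_real: "local_rep c (UNIV, \<lambda>x. x) f = (\<lambda>x. f (chart_inv c x))"
  by (simp add: local_rep_def)

text \<open>\<open>differentiable_map_at\<close> supplies a single chart; the change-of-chart rule
  carries differentiability to any other chart around \<open>p\<close>.\<close>

lemma differentiable_real_has_derivative:
  fixes A :: "('a, 'e::euclidean_space) atlas"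
  assumes M: "smooth_manifold X A" and f: "differentiable_map_at A real_atlas f p"
    and c: "c \<in> charts_at A p"
  shows "((\<lambda>x. f (chart_inv c x)) has_derivative
            frechet_derivative (\<lambda>x. f (chart_inv c x)) (at (snd c p))) (at (snd c p))"
proof -
  obtain d where d: "d \<in> charts_at A p" "local_rep d (UNIV, \<lambda>x. x) f differentiable (at (snd d p))"
    using f by (auto simp: differentiable_map_at_def charts_at_real_atlas)
  then obtain D where "(local_rep d (UNIV, \<lambda>x. x) f has_derivative D) (at (snd d p))"
    by (auto simp: differentiable_def)
  then have "local_rep c (UNIV, \<lambda>x. x) f differentiable (at (snd c p))"
    using local_rep_change_chart[OF M c d(1)] differentiableI by blast
  then show ?thesis by (simp add: frechet_derivative_works local_rep_real)
qed

text \<open>\<open>differential\<close> computes in a chart picked by \<open>SOME\<close>. The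
  transition derivative that appears on passing to \<open>c\<close> is absorbed by the compatibility
  of the coordinates of \<open>v\<close>.\<close>

lemma real_differential_eq:
  fixes A :: "('a, 'e::euclidean_space) atlas"
  assumes M: "smooth_manifold X A" and f: "differentiable_map_at A real_atlas f p"
    and c: "c \<in> charts_at A p" and v: "v \<in> tangent_space A p"
  shows "real_differential A f p v = frechet_derivative (\<lambda>x. f (chart_inv c x)) (at (snd c p)) (v c)"
proof -
  define d where "d = (SOME c. c \<in> charts_at A p)"
  have d: "d \<in> charts_at A p" unfolding d_def using c by (rule someI)
  have "(local_rep c (UNIV, \<lambda>x. x) f has_derivative
          frechet_derivative (\<lambda>x. f (chart_inv c x)) (at (snd c p))) (at (snd c p))"
    using differentiable_real_has_derivative[OF M f c] by (simp add: local_rep_real)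
  from local_rep_change_chart[OF M d c this]
  have "frechet_derivative (\<lambda>x. f (chart_inv d x)) (at (snd d p)) (v d)
      = frechet_derivative (\<lambda>x. f (chart_inv c x)) (at (snd c p))
          (frechet_derivative (transition d c) (at (snd d p)) (v d))"
    unfolding local_rep_real by (metis frechet_derivative_at)
  also have "frechet_derivative (transition d c) (at (snd d p)) (v d) = v c"
    by (rule tangent_space_transition[OF v d c])
  finally show ?thesis
    by (simp add: real_differential_def differential_def charts_at_real_atlas local_rep_real
        flip: d_def)
qed

section \<open>The tangent space and the tangent bundle as manifolds\<close>

lemma charts_at_tangent_space_atlas:
  assumes "v \<in> tangent_space A p"
  shows "charts_at (tangent_space_atlas A p) v = tangent_space_atlas A p"
  using assms by (auto simp: charts_at_def tangent_space_atlas_def)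

text \<open>Inverts the linear charts of the tangent space, so that maps on tangent vectors can be
  read as maps on \<open>'e\<close>.\<close>

lemma chart_inv_tangent_space:
  assumes M: "smooth_manifold X A" and c: "c \<in> charts_at A p"
  shows "chart_inv (tangent_space A p, \<lambda>v. v c) u = chart_vector A c p u"
proof -
  have "inj_on (\<lambda>v. v c) (tangent_space A p)"
    by (rule inj_on_inverseI) (rule chart_vector_coord[OF c])
  from inv_into_f_f[OF this chart_vector_mem[OF M c]]
  show ?thesis by (simp add: chart_inv_def chart_vector_same[OF M c])
qed

lemma chart_inv_tangent_bundle:
  assumes M: "smooth_manifold X A" and c: "c \<in> charts_at A p"
  shows "chart_inv (Sigma (fst c) (tangent_space A), \<lambda>(p, v). (snd c p, v c)) (snd c p, u)
    = (p, chart_vector A c p u)"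
proof -
  have cA: "c \<in> A" "p \<in> fst c" using c by (auto simp: charts_at_iff)
  have "inj_on (\<lambda>(p, v). (snd c p, v c)) (Sigma (fst c) (tangent_space A))"
  proof (rule inj_onI, clarify)
    fix q v r w
    assume q: "q \<in> fst c" "v \<in> tangent_space A q" and r: "r \<in> fst c" "w \<in> tangent_space A r"
      and eq: "snd c q = snd c r" "v c = w c"
    \<comment> \<open>The base points come first: the coordinate at \<open>c\<close> determines a
      vector only within one fibre.\<close>
    have qr: "q = r" by (rule inj_onD[OF chart_inj_on[OF M cA(1)] eq(1) q(1) r(1)])
    have c': "c \<in> charts_at A q" using cA(1) q(1) by (simp add: charts_at_iff)
    have "v = chart_vector A c q (v c)" by (rule chart_vector_coord[OF c' q(2), symmetric])
    also have "\<dots> = w"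
      unfolding eq(2) by (rule chart_vector_coord[OF c']) (simp add: qr r(2))
    finally show "q = r \<and> v = w" using qr by simp
  qed
  from inv_into_f_f[OF this, of "(p, chart_vector A c p u)"]
  show ?thesis
    using chart_vector_mem[OF M c] cA by (simp add: chart_inv_def chart_vector_same[OF M c])
qed

section \<open>Retractions and the chain rule at the zero vector\<close>

lemma retraction_zero:
  assumes "manifold_retraction A \<phi>" "p \<in> \<Union>(fst ` A)"
  shows "\<phi> p tzero = p"
  using assms unfolding manifold_retraction_def by blast

lemma retraction_differential:
  assumes "manifold_retraction A \<phi>" "p \<in> \<Union>(fst ` A)" "v \<in> tangent_space A p"
  shows "differential (tangent_space_atlas A p) A (\<phi> p) tzero (tangent_ident A p v) = v"
  using assms unfolding manifold_retraction_def by blast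

text \<open>Differentiability at \<open>(p, v)\<close> includes a chart of \<open>A\<close> around
  the value, so the value is a point of the manifold.\<close>

lemma retraction_mem:
  assumes "manifold_retraction A \<phi>" "p \<in> \<Union>(fst ` A)" "v \<in> tangent_space A p"
  shows "\<phi> p v \<in> \<Union>(fst ` A)"
proof -
  have "(p, v) \<in> \<Union>(fst ` tangent_bundle_atlas A)"
    using assms(2,3) by (auto simp: tangent_bundle_atlas_def)
  with assms(1) have "differentiable_map_at (tangent_bundle_atlas A) A (\<lambda>(p, v). \<phi> p v) (p, v)"
    unfolding manifold_retraction_def differentiable_map_def by blast
  then obtain d where "d \<in> charts_at A (\<phi> p v)"
    unfolding differentiable_map_at_def by auto
  then show ?thesis by (auto simp: charts_at_iff)
qed

text \<open>Differentiability on the tangent bundle is restricted to the fibre over \<open>p\<close>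
  by composing with an affine map into bundle coordinates. One target chart \<open>d\<close> serves
  all source charts \<open>c\<close>, so \<open>c\<close> may later be whichever one
  \<open>differential\<close> picks.\<close>

lemma retraction_coordinates:
  fixes A :: "('a, 'e::euclidean_space) atlas"
  assumes M: "smooth_manifold X A" and R: "manifold_retraction A \<phi>" and p: "p \<in> \<Union>(fst ` A)"
  obtains d where "d \<in> charts_at A p"
    "\<And>c. c \<in> charts_at A p \<Longrightarrow>
       (\<lambda>u. snd d (\<phi> p (chart_vector A c p u))) differentiable (at 0) \<and>
       (\<exists>W. open W \<and> 0 \<in> W \<and> (\<forall>u\<in>W. \<phi> p (chart_vector A c p u) \<in> fst d))"
proof -
  have "(p, tzero) \<in> \<Union>(fst ` tangent_bundle_atlas A)"
    using p tzero_mem[OF M] by (auto simp: tangent_bundle_atlas_def)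
  with R have "differentiable_map_at (tangent_bundle_atlas A) A (\<lambda>(p, v). \<phi> p v) (p, tzero)"
    unfolding manifold_retraction_def differentiable_map_def by blast
  moreover have "\<phi> p tzero = p" by (rule retraction_zero[OF R p])
  ultimately obtain C d V where C: "C \<in> charts_at (tangent_bundle_atlas A) (p, tzero)"
    and d: "d \<in> charts_at A p" and V: "open V" "snd C (p, tzero) \<in> V"
    and Vd: "\<And>x. x \<in> V \<Longrightarrow> (\<lambda>(p, v). \<phi> p v) (chart_inv C x) \<in> fst d"
    and diff: "local_rep C d (\<lambda>(p, v). \<phi> p v) differentiable (at (snd C (p, tzero)))"
    unfolding differentiable_map_at_def by auto
  obtain b where b: "b \<in> charts_at A p"
    and Cb: "C = (Sigma (fst b) (tangent_space A), \<lambda>(p, v). (snd b p, v b))"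
    using C by (auto simp: tangent_bundle_atlas_def charts_at_def)
  have Cinv: "chart_inv C (snd b p, u) = (p, chart_vector A b p u)" for u
    unfolding Cb by (rule chart_inv_tangent_bundle[OF M b])
  have C0: "snd C (p, tzero) = (snd b p, 0)" by (simp add: Cb tzero_def)
  show ?thesis
  proof (rule that[OF d])
    fix c assume c: "c \<in> charts_at A p"
    \<comment> \<open>The bundle chart comes from some chart \<open>b\<close>; \<open>L\<close>
      translates fibre coordinates from \<open>c\<close> to \<open>b\<close>.\<close>
    define L where "L = frechet_derivative (transition c b) (at (snd c p))"
    have L: "linear L" unfolding L_def by (rule linear_transition_derivative[OF M c b])
    have L0: "L 0 = 0" using L by (rule linear_0)
    have vec: "chart_vector A b p (L u) = chart_vector A c p u" for u
      using transition_derivative_compose[OF M c b] by (auto simp: chart_vector_def L_def)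
    \<comment> \<open>The inclusion of the fibre in bundle coordinates. Its first component is
      constant, so its derivative has first component 0.\<close>
    let ?j = "\<lambda>u. (snd b p, L u)"
    have j: "(?j has_derivative (\<lambda>u. (0, L u))) (at u)" for u
      using linear_imp_has_derivative[OF L] by (intro has_derivative_Pair) auto
    obtain D where D: "(local_rep C d (\<lambda>(p, v). \<phi> p v) has_derivative D) (at (?j 0))"
      using diff by (auto simp: differentiable_def C0 L0)
    have "((\<lambda>u. local_rep C d (\<lambda>(p, v). \<phi> p v) (?j u)) has_derivative (\<lambda>u. D (0, L u))) (at 0)"
      by (rule has_derivative_compose[OF j D])
    then have "((\<lambda>u. snd d (\<phi> p (chart_vector A c p u))) has_derivative (\<lambda>u. D (0, L u))) (at 0)"
      by (simp add: local_rep_def Cinv vec)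
    \<comment> \<open>The preimage of \<open>V\<close> under the inclusion is the witness for
      \<open>W\<close>.\<close>
    moreover have "open (?j -` V)"
      using V(1) has_derivative_continuous[OF j] by (intro open_vimage continuous_at_imp_continuous_on) auto
    moreover have "0 \<in> ?j -` V" using V(2) by (simp add: C0 L0)
    moreover have "\<phi> p (chart_vector A c p u) \<in> fst d" if "u \<in> ?j -` V" for u
      using Vd[of "?j u"] that by (simp add: Cinv vec)
    ultimately show "(\<lambda>u. snd d (\<phi> p (chart_vector A c p u))) differentiable (at 0) \<and>
       (\<exists>W. open W \<and> 0 \<in> W \<and> (\<forall>u\<in>W. \<phi> p (chart_vector A c p u) \<in> fst d))"
      by (meson differentiableI)
  qed
qed

text \<open>The linear chart of \<open>T\<^sub>pM\<close> picked by \<open>SOME\<close> in \<open>differential\<close> is the same for \<open>\<phi> p\<close> and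
  for \<open>f \<circ> \<phi> p\<close>, so no change of chart on \<open>T\<^sub>pM\<close> is needed in the second part.\<close>

lemma retraction_chain_rule:
  fixes A :: "('a, 'e::euclidean_space) atlas"
  assumes M: "smooth_manifold X A" and R: "manifold_retraction A \<phi>" and p: "p \<in> \<Union>(fst ` A)"
    and f: "differentiable_map_at A real_atlas f p"
  shows "differentiable_map_at (tangent_space_atlas A p) real_atlas (f \<circ> \<phi> p) tzero"
    and "v \<in> tangent_space A p \<Longrightarrow>
      real_differential (tangent_space_atlas A p) (f \<circ> \<phi> p) tzero (tangent_ident A p v)
        = real_differential A f p v"
proof -
  obtain d where d: "d \<in> charts_at A p"
    and coords: "\<And>c. c \<in> charts_at A p \<Longrightarrow>
       (\<lambda>u. snd d (\<phi> p (chart_vector A c p u))) differentiable (at 0) \<and>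
       (\<exists>W. open W \<and> 0 \<in> W \<and> (\<forall>u\<in>W. \<phi> p (chart_vector A c p u) \<in> fst d))"
    using retraction_coordinates[OF M R p] by metis
  have dA: "d \<in> A" using d by (simp add: charts_at_iff)
  have \<phi>0: "\<phi> p tzero = p" by (rule retraction_zero[OF R p])
  define Df where "Df = frechet_derivative (\<lambda>x. f (chart_inv d x)) (at (snd d p))"
  have Df: "((\<lambda>x. f (chart_inv d x)) has_derivative Df) (at (snd d p))"
    unfolding Df_def by (rule differentiable_real_has_derivative[OF M f d])
  \<comment> \<open>The Euclidean chain rule through the chart \<open>d\<close> around
    \<open>p\<close>; near 0 the map \<phi> stays in the domain of \<open>d\<close>, so inserting
    \<open>d\<close> and its inverse changes nothing there.\<close>
  have comp: "((\<lambda>u. f (\<phi> p (chart_vector A c p u))) has_derivative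
      (\<lambda>u. Df (frechet_derivative (\<lambda>u. snd d (\<phi> p (chart_vector A c p u))) (at 0) u))) (at 0)"
    if c: "c \<in> charts_at A p" for c
  proof -
    let ?H = "\<lambda>u. snd d (\<phi> p (chart_vector A c p u))"
    obtain W where W: "open W" "0 \<in> W" "\<And>u. u \<in> W \<Longrightarrow> \<phi> p (chart_vector A c p u) \<in> fst d"
      using coords[OF c] by blast
    have "chart_vector A c p 0 = tzero"
      using chart_vector_coord[OF c tzero_mem[OF M]] by (simp add: tzero_def)
    then have "?H 0 = snd d p" by (simp add: \<phi>0)
    moreover have "(?H has_derivative frechet_derivative ?H (at 0)) (at 0)"
      using coords[OF c] by (simp add: frechet_derivative_works)
    ultimately have "((\<lambda>u. f (chart_inv d (?H u))) has_derivative
        (\<lambda>u. Df (frechet_derivative ?H (at 0) u))) (at 0)"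
      using has_derivative_compose[of ?H _ 0 UNIV "\<lambda>x. f (chart_inv d x)" Df] Df by simp
    then show ?thesis
      by (rule has_derivative_transform_within_open[OF _ W(1,2)])
        (simp add: chart_inv_snd[OF M dA W(3)])
  qed
  have atlas: "charts_at (tangent_space_atlas A p) tzero = tangent_space_atlas A p"
    by (rule charts_at_tangent_space_atlas[OF tzero_mem[OF M]])
  have rep: "local_rep (tangent_space A p, \<lambda>v. v c) (UNIV, \<lambda>x. x) (f \<circ> \<phi> p)
      = (\<lambda>u. f (\<phi> p (chart_vector A c p u)))" if "c \<in> charts_at A p" for c
    by (simp add: local_rep_def chart_inv_tangent_space[OF M that])
  obtain c where c: "c \<in> charts_at A p" using d by blast
  show "differentiable_map_at (tangent_space_atlas A p) real_atlas (f \<circ> \<phi> p) tzero"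
    unfolding differentiable_map_at_def atlas charts_at_real_atlas
  proof (intro bexI exI conjI ballI)
    show "(tangent_space A p, \<lambda>v. v c) \<in> tangent_space_atlas A p"
      using c by (simp add: tangent_space_atlas_def)
    show "(UNIV, \<lambda>x. x) \<in> {(UNIV, \<lambda>x::real. x)}" "open (UNIV :: 'e set)" by simp_all
    \<comment> \<open>A linear chart is onto \<open>'e\<close>, so \<open>UNIV\<close> serves as the
      neighbourhood asked for.\<close>
    have "u \<in> (\<lambda>v. v c) ` tangent_space A p" for u
      using chart_vector_mem[OF M c] chart_vector_same[OF M c] by (metis imageI)
    then show "UNIV \<subseteq> snd (tangent_space A p, \<lambda>v. v c) ` fst (tangent_space A p, \<lambda>v. v c)"
      by auto
    show "local_rep (tangent_space A p, \<lambda>v. v c) (UNIV, \<lambda>x. x) (f \<circ> \<phi> p)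
        differentiable (at (snd (tangent_space A p, \<lambda>v. v c) tzero))"
      using comp[OF c] by (auto simp: rep[OF c] tzero_def intro: differentiableI)
  qed simp_all
  define e where "e = (SOME e. e \<in> charts_at (tangent_space_atlas A p) tzero)"
  have e_mem: "e \<in> tangent_space_atlas A p"
    unfolding e_def atlas
    by (rule someI_ex) (use c in \<open>auto simp: tangent_space_atlas_def\<close>)
  then obtain b where b: "b \<in> charts_at A p" and e: "e = (tangent_space A p, \<lambda>v. v b)"
    by (auto simp: tangent_space_atlas_def)
  assume v: "v \<in> tangent_space A p"
  have ident: "tangent_ident A p v e = v b" using e_mem by (simp add: tangent_ident_def e)
  \<comment> \<open>The \<open>d\<close>-coordinate of the axiom that the differential of the
    retraction at 0 is the identity.\<close>
  have "v d = differential (tangent_space_atlas A p) A (\<phi> p) tzero (tangent_ident A p v) d"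
    by (simp only: retraction_differential[OF R p v])
  also have "\<dots> = frechet_derivative (\<lambda>u. snd d (\<phi> p (chart_vector A b p u))) (at 0) (v b)"
    unfolding differential_def e_def[symmetric] Let_def ident
    \<comment> \<open>Rewriting the image point to \<open>p\<close> makes \<open>d\<close> a chart
      around it, which selects the derivative branch of \<open>differential\<close> instead of the
      default 0.\<close>
    unfolding \<phi>0 using d
    by (simp add: e local_rep_def chart_inv_tangent_space[OF M b] tzero_def)
  finally have vd: "v d = \<dots>" .
  have "real_differential (tangent_space_atlas A p) (f \<circ> \<phi> p) tzero (tangent_ident A p v)
      = frechet_derivative (\<lambda>u. f (\<phi> p (chart_vector A b p u))) (at 0) (v b)"
    unfolding real_differential_def differential_def e_def[symmetric] Let_def ident
    by (simp add: charts_at_real_atlas e rep[OF b] tzero_def)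
  also have "\<dots> = Df (v d)"
    using frechet_derivative_at[OF comp[OF b]] vd by metis
  also have "\<dots> = real_differential A f p v"
    unfolding Df_def by (rule real_differential_eq[OF M f d v, symmetric])
  finally show "real_differential (tangent_space_atlas A p) (f \<circ> \<phi> p) tzero (tangent_ident A p v)
      = real_differential A f p v" .
qed

text \<open>Both gradients are given by \<open>THE\<close>, and the chain rule makes the two
  predicates coincide. The descriptions therefore agree before the gradient is known to
  exist.\<close>

lemma tangent_gradient_retraction:
  fixes A :: "('a, 'e::euclidean_space) atlas"
  assumes "smooth_manifold X A" "manifold_retraction A \<phi>" "p \<in> \<Union>(fst ` A)"
    and "differentiable_map_at A real_atlas f p"
  shows "tangent_gradient A g p (f \<circ> \<phi> p) tzero = riemannian_gradient A g f p"
  unfolding tangent_gradient_def riemannian_gradient_def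
  using retraction_chain_rule(2)[OF assms] by (intro arg_cong[where f = The]) auto

section \<open>Existence of the gradient\<close>

text \<open>Definiteness makes the map from \<open>u\<close> to the functional \<open>G u\<close>
  injective, and in finite dimension an injective linear map between spaces of equal dimension is
  surjective.\<close>

lemma positive_definite_riesz:
  fixes G :: "'e::euclidean_space \<Rightarrow> 'e \<Rightarrow> real"
  assumes left: "\<And>w. linear (\<lambda>u. G u w)" and right: "\<And>u. linear (G u)"
    and pos: "\<And>u. u \<noteq> 0 \<Longrightarrow> G u u > 0" and l: "linear l"
  shows "\<exists>!u. \<forall>w. G u w = l w"
proof -
  \<comment> \<open>Encodes the functional \<open>G u\<close> by its coefficients on
    \<open>Basis\<close>, which gives an endomorphism of \<open>'e\<close>.\<close>
  define T where "T u = (\<Sum>b\<in>Basis. G u b *\<^sub>R b)" for u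
  have inner: "T u \<bullet> b = G u b" if "b \<in> Basis" for u b
    using that by (simp add: T_def inner_sum_left_Basis)
  have lin: "linear T"
    by (rule linearI)
      (simp_all add: T_def linear_add[OF left] linear_scale[OF left] scaleR_add_left sum.distrib
        scaleR_sum_right)
  \<comment> \<open>Nondegeneracy, by testing against \<open>w = u\<close>.\<close>
  have zero: "u = 0" if "\<And>w. G u w = 0" for u
    using pos[of u] that by force
  have on_basis: "G u w = m w"
    if m: "linear m" and eq: "\<And>b. b \<in> Basis \<Longrightarrow> G u b = m b" for u m w
    by (rule linear_eq_on[OF right m, of w Basis]) (simp_all add: span_Basis eq)
  have "inj T"
    unfolding linear_injective_0[OF lin]
  proof (intro allI impI)
    fix u assume "T u = 0"
    then have "G u b = 0" if "b \<in> Basis" for b using inner[OF that, of u] by simp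
    then have "G u w = 0" for w using on_basis[of "\<lambda>_. 0" u w] linear_zero by blast
    then show "u = 0" by (rule zero)
  qed
  then have "surj T" using linear_injective_imp_surjective[OF lin] by simp
  then obtain u where u: "T u = (\<Sum>b\<in>Basis. l b *\<^sub>R b)" by (metis surjD)
  have "G u b = l b" if "b \<in> Basis" for b
    using inner[OF that, of u] that unfolding u by (simp add: inner_sum_left_Basis)
  then have sol: "\<forall>w. G u w = l w" using on_basis[OF l] by blast
  show ?thesis
  proof (rule ex1I[where a = u])
    show "\<forall>w. G u w = l w" by (rule sol)
  next
    fix u' assume u': "\<forall>w. G u' w = l w"
    have "u' - u = 0"
      by (rule zero) (use u' sol in \<open>simp add: linear_diff[OF left]\<close>)
    then show "u' = u" by simp
  qed
qed

lemma riemannian_metric_commute: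
  assumes "riemannian_metric A g" "p \<in> \<Union>(fst ` A)"
    and "u \<in> tangent_space A p" "v \<in> tangent_space A p"
  shows "g p u v = g p v u"
  using assms unfolding riemannian_metric_def by blast

lemma riemannian_metric_linear_left:
  assumes "riemannian_metric A g" "p \<in> \<Union>(fst ` A)"
    and "u \<in> tangent_space A p" "v \<in> tangent_space A p" "w \<in> tangent_space A p"
  shows "g p (tadd (tscale a u) v) w = a * g p u w + g p v w"
  using assms unfolding riemannian_metric_def by blast

lemma riemannian_metric_pos:
  assumes "riemannian_metric A g" "p \<in> \<Union>(fst ` A)" "v \<in> tangent_space A p" "v \<noteq> tzero"
  shows "g p v v > 0"
  using assms unfolding riemannian_metric_def by blast

text \<open>In the coordinates of one chart, \<open>g p\<close> is a positive definite bilinear form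
  and the differential of \<open>f\<close> a linear functional, so exactly one vector represents it.
  Hence the \<open>THE\<close> in \<open>riemannian_gradient\<close> denotes a tangent
  vector.\<close>

lemma riemannian_gradient_mem:
  fixes A :: "('a, 'e::euclidean_space) atlas"
  assumes M: "smooth_manifold X A" and g: "riemannian_metric A g" and p: "p \<in> \<Union>(fst ` A)"
    and f: "differentiable_map_at A real_atlas f p"
  shows "riemannian_gradient A g f p \<in> tangent_space A p"
proof -
  obtain c where c: "c \<in> charts_at A p" using charts_at_nonempty[OF p] .
  let ?V = "chart_vector A c p"
  define G where "G u w = g p (?V u) (?V w)" for u w
  define l where "l = frechet_derivative (\<lambda>x. f (chart_inv c x)) (at (snd c p))"
  have mem: "?V u \<in> tangent_space A p" for u by (rule chart_vector_mem[OF M c])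
  have sym: "G u w = G w u" for u w
    unfolding G_def by (rule riemannian_metric_commute[OF g p mem mem])
  have comb: "G (a *\<^sub>R u + u') w = a * G u w + G u' w" for a u u' w
    unfolding G_def chart_vector_linear[OF M c]
    by (rule riemannian_metric_linear_left[OF g p mem mem mem])
  have left: "linear (\<lambda>u. G u w)" for w
  proof (rule linearI)
    show add: "G (u + u') w = G u w + G u' w" for u u' using comb[of 1 u u' w] by simp
    \<comment> \<open>Here \<open>comb\<close> is used with \<open>u' = 0\<close>; additivity at
      \<open>0 + 0\<close> gives \<open>G 0 w = 0\<close>.\<close>
    show "G (a *\<^sub>R u) w = a *\<^sub>R G u w" for a u
      using comb[of a u 0 w] add[of 0 0] by simp
  qed
  have right: "linear (G u)" for u
  proof -
    have "G u = (\<lambda>w. G w u)" using sym by blast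
    then show ?thesis using left[of u] by simp
  qed
  have pos: "G u u > 0" if "u \<noteq> 0" for u
  proof -
    have "?V u \<noteq> tzero" using that chart_vector_same[OF M c, of u] by (auto simp: tzero_def)
    then show ?thesis unfolding G_def by (rule riemannian_metric_pos[OF g p mem])
  qed
  have "linear l"
    unfolding l_def using differentiable_real_has_derivative[OF M f c] has_derivative_linear by blast
  from positive_definite_riesz[OF left right pos this]
  obtain u where u: "\<And>w. G u w = l w" and uniq: "\<And>u'. (\<And>w. G u' w = l w) \<Longrightarrow> u' = u" by metis
  have rd: "real_differential A f p v = l (v c)" if "v \<in> tangent_space A p" for v
    unfolding l_def by (rule real_differential_eq[OF M f c that])
  have "\<exists>!w. w \<in> tangent_space A p \<and> (\<forall>v\<in>tangent_space A p. g p w v = real_differential A f p v)"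
  proof (rule ex1I)
    show "?V u \<in> tangent_space A p \<and>
        (\<forall>v\<in>tangent_space A p. g p (?V u) v = real_differential A f p v)"
    proof (intro conjI ballI mem)
      fix v assume v: "v \<in> tangent_space A p"
      show "g p (?V u) v = real_differential A f p v"
        using u[of "v c"] by (simp add: G_def chart_vector_coord[OF c v] rd[OF v])
    qed
  next
    fix w
    assume w: "w \<in> tangent_space A p \<and> (\<forall>v\<in>tangent_space A p. g p w v = real_differential A f p v)"
    \<comment> \<open>Any other candidate has coordinates solving the same equation on
      \<open>'e\<close>, where the solution is unique.\<close>
    have "G (w c) x = l x" for x
      using w mem rd[OF mem] by (simp add: G_def chart_vector_coord[OF c] chart_vector_same[OF M c])
    then have "w c = u" by (rule uniq)
    then show "w = ?V u" using w chart_vector_coord[OF c] by metis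
  qed
  from theI'[OF this] show ?thesis unfolding riemannian_gradient_def by blast
qed

section \<open>Gradient descent and dynamic trivialization\<close>

text \<open>The update map \<open>r\<close> is kept general so that the induction covers both a
  retraction and the exponential map.\<close>

lemma riemannian_gradient_descent_mem:
  fixes A :: "('a, 'e::euclidean_space) atlas"
  assumes M: "smooth_manifold X A" and g: "riemannian_metric A g"
    and f: "differentiable_map A real_atlas f"
    and r: "\<And>q v. q \<in> \<Union>(fst ` A) \<Longrightarrow> v \<in> tangent_space A q \<Longrightarrow> r q v \<in> \<Union>(fst ` A)"
    and p: "riemannian_gradient_descent A g f r \<eta> p" "p 0 \<in> \<Union>(fst ` A)"
  shows "p i \<in> \<Union>(fst ` A)"
proof (induction i)
  case 0
  then show ?case by (rule p(2))
next
  case (Suc i)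
  then have "tscale (- \<eta>) (riemannian_gradient A g f (p i)) \<in> tangent_space A (p i)"
    using f by (intro tscale_mem[OF M] riemannian_gradient_mem[OF M g])
      (auto simp: differentiable_map_def)
  with Suc r have "r (p i) (tscale (- \<eta>) (riemannian_gradient A g f (p i))) \<in> \<Union>(fst ` A)"
    by blast
  then show ?case using p(1) by (simp add: riemannian_gradient_descent_def)
qed

text \<open>Any optimizer is allowed: a run is required to stay in the tangent space, and the
  retraction maps that space into the manifold.\<close>

lemma dynamic_trivialization_mem:
  assumes R: "manifold_retraction A \<phi>" and D: "dynamic_trivialization A f \<phi> opt K p0 p y"
  shows "p i \<in> \<Union>(fst ` A)"
proof (induction i)
  case 0
  then show ?case using D by (simp add: dynamic_trivialization_def)
next
  case (Suc i)
  have "y i K \<in> tangent_space A (p i)" "p (Suc i) = \<phi> (p i) (y i K)"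
    using D by (auto simp: dynamic_trivialization_def)
  then show ?case using retraction_mem[OF R Suc] by metis
qed

text \<open>With \<open>K = 1\<close> the only optimizer step starts at the zero vector, where the
  gradient of the pulled-back function is the Riemannian gradient.\<close>

lemma dynamic_trivialization_sgd_step:
  fixes A :: "('a, 'e::euclidean_space) atlas"
  assumes M: "smooth_manifold X A" and f: "differentiable_map A real_atlas f"
    and R: "manifold_retraction A \<phi>"
    and D: "dynamic_trivialization A f \<phi> (sgd A g \<eta>) 1 p0 p y"
  shows "y i 1 = tscale (- \<eta>) (riemannian_gradient A g f (p i))"
    and "p (Suc i) = \<phi> (p i) (tscale (- \<eta>) (riemannian_gradient A g f (p i)))"
proof -
  have p: "p i \<in> \<Union>(fst ` A)" by (rule dynamic_trivialization_mem[OF R D])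
  then have "differentiable_map_at A real_atlas f (p i)"
    using f by (auto simp: differentiable_map_def)
  with M R p have "tangent_gradient A g (p i) (f \<circ> \<phi> (p i)) tzero = riemannian_gradient A g f (p i)"
    by (intro tangent_gradient_retraction)
  then show y: "y i 1 = tscale (- \<eta>) (riemannian_gradient A g f (p i))"
    using D by (simp add: dynamic_trivialization_def sgd_def tadd_tzero)
  show "p (Suc i) = \<phi> (p i) (tscale (- \<eta>) (riemannian_gradient A g f (p i)))"
    unfolding y[symmetric] using D by (simp add: dynamic_trivialization_def)
qed

text \<open>From left to right this is the update formula at every step. Conversely, the iterates
  \<open>y\<close> are rebuilt from \<open>p\<close>; they must be tangent vectors, which is where
  existence of the gradient enters.\<close>

lemma dynamic_trivialization_sgd_iff:
  fixes A :: "('a, 'e::euclidean_space) atlas"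
  assumes M: "smooth_manifold X A" and g: "riemannian_metric A g"
    and f: "differentiable_map A real_atlas f" and R: "manifold_retraction A \<phi>"
    and p0: "p0 \<in> \<Union>(fst ` A)"
  shows "(\<exists>y. dynamic_trivialization A f \<phi> (sgd A g \<eta>) 1 p0 p y) \<longleftrightarrow>
    p 0 = p0 \<and> riemannian_gradient_descent A g f \<phi> \<eta> p"
proof
  assume "\<exists>y. dynamic_trivialization A f \<phi> (sgd A g \<eta>) 1 p0 p y"
  then obtain y where D: "dynamic_trivialization A f \<phi> (sgd A g \<eta>) 1 p0 p y" ..
  then show "p 0 = p0 \<and> riemannian_gradient_descent A g f \<phi> \<eta> p"
    using dynamic_trivialization_sgd_step(2)[OF M f R D]
    by (simp add: dynamic_trivialization_def riemannian_gradient_descent_def)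
next
  assume p: "p 0 = p0 \<and> riemannian_gradient_descent A g f \<phi> \<eta> p"
  \<comment> \<open>Only the indices 0 and 1 are inspected when \<open>K = 1\<close>, so one value
    can serve all positive \<open>k\<close>.\<close>
  define y :: "nat \<Rightarrow> nat \<Rightarrow> ('a, 'e) tangent" where
    "y i k = (if k = 0 then tzero else tscale (- \<eta>) (riemannian_gradient A g f (p i)))" for i k
  have start: "p 0 \<in> \<Union>(fst ` A)" using p p0 by simp
  have mem: "p i \<in> \<Union>(fst ` A)" for i
    by (rule riemannian_gradient_descent_mem[OF M g f retraction_mem[OF R] conjunct2[OF p] start])
  then have fi: "differentiable_map_at A real_atlas f (p i)" for i
    using f by (auto simp: differentiable_map_def)
  have "y i k \<in> tangent_space A (p i)" for i k
    by (simp add: y_def tzero_mem[OF M] tscale_mem[OF M riemannian_gradient_mem[OF M g mem fi]])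
  moreover have "sgd A g \<eta> (p i) (f \<circ> \<phi> (p i)) 1 (y i)" for i
    by (simp add: sgd_def y_def tadd_tzero tangent_gradient_retraction[OF M R mem fi])
  ultimately have "dynamic_trivialization A f \<phi> (sgd A g \<eta>) 1 p0 p y"
    using p p0 by (auto simp: dynamic_trivialization_def riemannian_gradient_descent_def y_def)
  then show "\<exists>y. dynamic_trivialization A f \<phi> (sgd A g \<eta>) 1 p0 p y"
    by (intro exI[where x = y])
qed

text \<open>The two maps are known to agree only on tangent vectors over the manifold; the iterates
  never leave it, and the gradients are tangent vectors.\<close>

lemma riemannian_gradient_descent_cong:
  fixes A :: "('a, 'e::euclidean_space) atlas"
  assumes M: "smooth_manifold X A" and g: "riemannian_metric A g"
    and f: "differentiable_map A real_atlas f"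
    and r: "\<And>q v. q \<in> \<Union>(fst ` A) \<Longrightarrow> v \<in> tangent_space A q \<Longrightarrow> r q v \<in> \<Union>(fst ` A)"
    and eq: "\<And>q v. q \<in> \<Union>(fst ` A) \<Longrightarrow> v \<in> tangent_space A q \<Longrightarrow> r q v = s q v"
    and p: "p 0 \<in> \<Union>(fst ` A)"
  shows "riemannian_gradient_descent A g f r \<eta> p \<longleftrightarrow> riemannian_gradient_descent A g f s \<eta> p"
proof -
  \<comment> \<open>Lets the membership induction run along \<open>s\<close> too, as the converse
    implication demands.\<close>
  have s: "s q v \<in> \<Union>(fst ` A)" if "q \<in> \<Union>(fst ` A)" "v \<in> tangent_space A q" for q v
    using r[OF that] eq[OF that] by simp
  have step: "r (p i) (tscale (- \<eta>) (riemannian_gradient A g f (p i)))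
      = s (p i) (tscale (- \<eta>) (riemannian_gradient A g f (p i)))" if "p i \<in> \<Union>(fst ` A)" for i
    using that f by (intro eq tscale_mem[OF M] riemannian_gradient_mem[OF M g])
      (auto simp: differentiable_map_def)
  show ?thesis
  proof
    assume *: "riemannian_gradient_descent A g f r \<eta> p"
    show "riemannian_gradient_descent A g f s \<eta> p"
      using * step[OF riemannian_gradient_descent_mem[OF M g f r * p]]
      by (simp add: riemannian_gradient_descent_def)
  next
    assume *: "riemannian_gradient_descent A g f s \<eta> p"
    show "riemannian_gradient_descent A g f r \<eta> p"
      using * step[OF riemannian_gradient_descent_mem[OF M g f s * p]]
      by (simp add: riemannian_gradient_descent_def)
  qed
qed

theorem mainTheorem4:
  fixes X :: "'a topology" and A :: "('a, 'e::euclidean_space) atlas"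
    and g :: "('a, 'e) metric" and f :: "'a \<Rightarrow> real"
    and \<phi> :: "'a \<Rightarrow> ('a, 'e) tangent \<Rightarrow> 'a" and p0 :: 'a
  assumes "smooth_manifold X A" and "connected_space X"
    and "riemannian_metric A g"
    and "differentiable_map A real_atlas f"
    and "manifold_retraction A \<phi>"
    and "p0 \<in> topspace X"
  shows
    "(\<forall>opt p y. dynamic_trivialization A f \<phi> opt 1 p0 p y \<longrightarrow>
        (\<forall>i. differentiable_map_at (tangent_space_atlas A (p i)) real_atlas (f \<circ> \<phi> (p i)) tzero \<and>
           (\<forall>v\<in>tangent_space A (p i).
              let d\<phi> = differential (tangent_space_atlas A (p i)) A (\<phi> (p i)) tzero;
                  \<iota> = tangent_ident A (p i) in
              real_differential (tangent_space_atlas A (p i)) (f \<circ> \<phi> (p i)) tzero (\<iota> v)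
                = real_differential A f (\<phi> (p i) tzero) (d\<phi> (\<iota> v)) \<and>
              real_differential A f (\<phi> (p i) tzero) (d\<phi> (\<iota> v))
                = real_differential A f (\<phi> (p i) tzero) v \<and>
              real_differential A f (\<phi> (p i) tzero) v = real_differential A f (p i) v) \<and>
           tangent_gradient A g (p i) (f \<circ> \<phi> (p i)) tzero = riemannian_gradient A g f (p i)))
   \<and> (\<forall>\<eta>>0. \<forall>p y. dynamic_trivialization A f \<phi> (sgd A g \<eta>) 1 p0 p y \<longrightarrow>
        (\<forall>i. y i 1 = tscale (- \<eta>) (riemannian_gradient A g f (p i)) \<and>
           p (Suc i) = \<phi> (p i) (tscale (- \<eta>) (riemannian_gradient A g f (p i)))))
   \<and> (\<forall>\<eta>>0. \<forall>p. (\<exists>y. dynamic_trivialization A f \<phi> (sgd A g \<eta>) 1 p0 p y) \<longleftrightarrow>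
        p 0 = p0 \<and> riemannian_gradient_descent A g f \<phi> \<eta> p)
   \<and> (complete_riemannian_metric A g \<longrightarrow>
      (\<forall>q\<in>topspace X. \<forall>v\<in>tangent_space A q. \<phi> q v = exp_map A g q v) \<longrightarrow>
      (\<forall>\<eta>>0. \<forall>p. (\<exists>y. dynamic_trivialization A f \<phi> (sgd A g \<eta>) 1 p0 p y) \<longleftrightarrow>
        p 0 = p0 \<and> riemannian_gradient_descent A g f (exp_map A g) \<eta> p))"
proof -
  have top: "topspace X = \<Union>(fst ` A)" by (rule smooth_manifold_topspace[OF assms(1)])
  have p0: "p0 \<in> \<Union>(fst ` A)" using assms(6) top by simp
  note sgd_iff = dynamic_trivialization_sgd_iff[OF assms(1,3,4,5) p0]
  show ?thesis
  proof (intro conjI allI impI)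
    fix opt p y i
    assume D: "dynamic_trivialization A f \<phi> opt 1 p0 p y"
    have p: "p i \<in> \<Union>(fst ` A)" by (rule dynamic_trivialization_mem[OF assms(5) D])
    have f: "differentiable_map_at A real_atlas f (p i)"
      using assms(4) p by (auto simp: differentiable_map_def)
    show "differentiable_map_at (tangent_space_atlas A (p i)) real_atlas (f \<circ> \<phi> (p i)) tzero"
      by (rule retraction_chain_rule(1)[OF assms(1,5) p f])
    \<comment> \<open>Simplification replaces the image of 0 by \<open>p i\<close> and the
      differential of \<phi> by the identity; what is left of the chain of equations is the chain
      rule.\<close>
    show "\<forall>v\<in>tangent_space A (p i).
        let d\<phi> = differential (tangent_space_atlas A (p i)) A (\<phi> (p i)) tzero;
            \<iota> = tangent_ident A (p i) in
        real_differential (tangent_space_atlas A (p i)) (f \<circ> \<phi> (p i)) tzero (\<iota> v)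
          = real_differential A f (\<phi> (p i) tzero) (d\<phi> (\<iota> v)) \<and>
        real_differential A f (\<phi> (p i) tzero) (d\<phi> (\<iota> v))
          = real_differential A f (\<phi> (p i) tzero) v \<and>
        real_differential A f (\<phi> (p i) tzero) v = real_differential A f (p i) v"
      by (simp add: Let_def retraction_chain_rule(2)[OF assms(1,5) p f]
          retraction_zero[OF assms(5) p] retraction_differential[OF assms(5) p])
    show "tangent_gradient A g (p i) (f \<circ> \<phi> (p i)) tzero = riemannian_gradient A g f (p i)"
      by (rule tangent_gradient_retraction[OF assms(1,5) p f])
  next
    fix \<eta> :: real and p y i
    assume D: "dynamic_trivialization A f \<phi> (sgd A g \<eta>) 1 p0 p y"
    show "y i 1 = tscale (- \<eta>) (riemannian_gradient A g f (p i))"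
      "p (Suc i) = \<phi> (p i) (tscale (- \<eta>) (riemannian_gradient A g f (p i)))"
      using dynamic_trivialization_sgd_step[OF assms(1,4,5) D] by blast+
  next
    fix \<eta> :: real and p
    show "(\<exists>y. dynamic_trivialization A f \<phi> (sgd A g \<eta>) 1 p0 p y) \<longleftrightarrow>
        p 0 = p0 \<and> riemannian_gradient_descent A g f \<phi> \<eta> p"
      by (rule sgd_iff)
  next
    fix \<eta> :: real and p
    assume exp: "\<forall>q\<in>topspace X. \<forall>v\<in>tangent_space A q. \<phi> q v = exp_map A g q v"
    \<comment> \<open>The initial condition places the start of the iteration in the manifold, so
      descent along \<phi> and along \<open>exp_map A g\<close> can be interchanged.\<close>
    have "riemannian_gradient_descent A g f \<phi> \<eta> p
        \<longleftrightarrow> riemannian_gradient_descent A g f (exp_map A g) \<eta> p" if "p 0 = p0"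
      by (rule riemannian_gradient_descent_cong[OF assms(1,3,4) retraction_mem[OF assms(5)]])
        (use exp that p0 top in auto)
    then show "(\<exists>y. dynamic_trivialization A f \<phi> (sgd A g \<eta>) 1 p0 p y) \<longleftrightarrow>
        p 0 = p0 \<and> riemannian_gradient_descent A g f (exp_map A g) \<eta> p"
      using sgd_iff by blast
  qed
qed

end
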